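(* Let the accuracy parameter $\epsilon$ be at most $0.1$ and the failure probability parameter $\delta$ at most $0.1$. Then, in the realizable setting, any TDS learning algorithm for the class of indicators of convex sets (functions $\mathbb{R}^d\to\{\pm1\}$ equal to $+1$ exactly on a convex set) under the standard Gaussian distribution on $\mathbb{R}^d$ requires either $2^{0.04d}$ training samples or $2^{0.04d}$ testing samples, for all sufficiently large $d$.
   Context: Realizable TDS learning of a class $\mathcal{C}$ w.r.t. $\mathcal{D}$: the algorithm receives i.i.d. labelled training samples with marginal $\mathcal{D}$ and i.i.d. unlabelled test samples from $\mathcal{D}^{\mathrm{test}}_{\mathcal{X}}$, all labelled by a common $f^*\in\mathcal{C}$; it rejects or accepts with output $h$. Soundness: with probability $\ge1-\delta$, acceptance implies $\Pr_{\mathcal{D}^{\mathrm{test}}_{\mathcal{X}}}[h\ne f^*]\le\epsilon$. Completeness: if $\mathcal{D}^{\mathrm{test}}_{\mathcal{X}}=\mathcal{D}$ it accepts with probability $\ge1-\delta$. *)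

theory Defs
  imports "HOL-Probability.Probability"
begin

text \<open>
  The space \<open>\<real>\<^sup>d\<close>, for a dimension \<open>d\<close> that varies inside the statement, is
  \<open>{..<d} \<rightarrow>\<^sub>E UNIV\<close>, the space of the product measure below.
\<close>

definition std_gaussian :: "nat \<Rightarrow> (nat \<Rightarrow> real) measure" where
  "std_gaussian d = (\<Pi>\<^sub>M i\<in>{..<d}. density lborel std_normal_density)"

text \<open>
  The type \<^typ>\<open>nat \<Rightarrow> real\<close> is not a real vector space in the library, so \<^const>\<open>convex\<close> does
  not apply to it; the definition is repeated for coordinatewise operations.
\<close>

definition convex_in :: "nat \<Rightarrow> (nat \<Rightarrow> real) set \<Rightarrow> bool" where
  "convex_in d K \<longleftrightarrow> K \<subseteq> {..<d} \<rightarrow>\<^sub>E UNIV \<and>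
     (\<forall>x\<in>K. \<forall>y\<in>K. \<forall>u\<ge>0. \<forall>v\<ge>0. u + v = 1 \<longrightarrow> (\<lambda>i\<in>{..<d}. u * x i + v * y i) \<in> K)"

definition convex_indicators :: "nat \<Rightarrow> ((nat \<Rightarrow> real) \<Rightarrow> int) set" where
  "convex_indicators d = {(\<lambda>x. if x \<in> K then 1 else - 1) | K. convex_in d K}"

abbreviation labels :: "int measure" where
  "labels \<equiv> count_space {- 1, 1}"

definition labelled :: "'x measure \<Rightarrow> ('x \<Rightarrow> int) \<Rightarrow> ('x \<times> int) measure" where
  "labelled D f = distr D (D \<Otimes>\<^sub>M labels) (\<lambda>x. (x, f x))"

text \<open>
  Inputs of an algorithm: \<open>m\<close> labelled training points, \<open>n\<close> unlabelled test points and a random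
  seed. Only the \<open>\<sigma>\<close>-algebra of \<open>tds_inputs\<close> matters; \<open>tds_experiment\<close> is the law of the input.
\<close>

type_synonym ('x, 'r) tds_input = "(nat \<Rightarrow> 'x \<times> int) \<times> (nat \<Rightarrow> 'x) \<times> 'r"

definition tds_inputs :: "'x measure \<Rightarrow> nat \<Rightarrow> nat \<Rightarrow> 'r measure \<Rightarrow> ('x, 'r) tds_input measure" where
  "tds_inputs D m n R =
     (\<Pi>\<^sub>M i\<in>{..<m}. D \<Otimes>\<^sub>M labels) \<Otimes>\<^sub>M (\<Pi>\<^sub>M i\<in>{..<n}. D) \<Otimes>\<^sub>M R"

definition tds_experiment ::
  "'x measure \<Rightarrow> 'x measure \<Rightarrow> ('x \<Rightarrow> int) \<Rightarrow> nat \<Rightarrow> nat \<Rightarrow> 'r measure \<Rightarrow> ('x, 'r) tds_input measure" where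
  "tds_experiment D D' f m n R =
     (\<Pi>\<^sub>M i\<in>{..<m}. labelled D f) \<Otimes>\<^sub>M (\<Pi>\<^sub>M i\<in>{..<n}. D') \<Otimes>\<^sub>M R"

text \<open>
  A randomized algorithm: \<^term>\<open>None\<close> is rejection, \<^term>\<open>Some h\<close> is acceptance with output \<open>h\<close>.
  The last condition says that the acceptance event is measurable and that \<open>h x\<close> is jointly
  measurable in the input and in \<open>x\<close> (\<open>0\<close> marks rejection); it makes the events in
  \<open>tds_sound\<close> and \<open>tds_complete\<close> measurable.
\<close>

definition tds_algorithm ::
  "'x measure \<Rightarrow> nat \<Rightarrow> nat \<Rightarrow> 'r measure \<Rightarrow> (('x, 'r) tds_input \<Rightarrow> ('x \<Rightarrow> int) option) \<Rightarrow> bool" where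
  "tds_algorithm D m n R A \<longleftrightarrow> prob_space R \<and>
     (\<forall>z\<in>space (tds_inputs D m n R). \<forall>h. A z = Some h \<longrightarrow> h \<in> measurable D labels) \<and>
     (\<lambda>(z, x). case A z of None \<Rightarrow> 0 | Some h \<Rightarrow> h x)
       \<in> measurable (tds_inputs D m n R \<Otimes>\<^sub>M D) (count_space {- 1, 0, 1})"

text \<open>
  The ground truth \<open>f\<close> ranges over the measurable members of the class \<open>C\<close>, since the labelled
  distribution and the test error have no meaning otherwise (a convex set need not be Borel).
\<close>

definition tds_sound ::
  "'x measure \<Rightarrow> ('x \<Rightarrow> int) set \<Rightarrow> real \<Rightarrow> real \<Rightarrow> nat \<Rightarrow> nat \<Rightarrow> 'r measure \<Rightarrow>
   (('x, 'r) tds_input \<Rightarrow> ('x \<Rightarrow> int) option) \<Rightarrow> bool" where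
  "tds_sound D C \<epsilon> \<delta> m n R A \<longleftrightarrow>
     (\<forall>f \<in> C \<inter> measurable D labels. \<forall>D'. prob_space D' \<and> sets D' = sets D \<longrightarrow>
        \<P>(z in tds_experiment D D' f m n R.
           \<forall>h. A z = Some h \<longrightarrow> \<P>(x in D'. h x \<noteq> f x) \<le> \<epsilon>) \<ge> 1 - \<delta>)"

definition tds_complete ::
  "'x measure \<Rightarrow> ('x \<Rightarrow> int) set \<Rightarrow> real \<Rightarrow> nat \<Rightarrow> nat \<Rightarrow> 'r measure \<Rightarrow>
   (('x, 'r) tds_input \<Rightarrow> ('x \<Rightarrow> int) option) \<Rightarrow> bool" where
  "tds_complete D C \<delta> m n R A \<longleftrightarrow>
     (\<forall>f \<in> C \<inter> measurable D labels.
        \<P>(z in tds_experiment D D f m n R. A z \<noteq> None) \<ge> 1 - \<delta>)"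

definition tds_learner ::
  "'x measure \<Rightarrow> ('x \<Rightarrow> int) set \<Rightarrow> real \<Rightarrow> real \<Rightarrow> nat \<Rightarrow> nat \<Rightarrow> 'r measure \<Rightarrow>
   (('x, 'r) tds_input \<Rightarrow> ('x \<Rightarrow> int) option) \<Rightarrow> bool" where
  "tds_learner D C \<epsilon> \<delta> m n R A \<longleftrightarrow>
     tds_algorithm D m n R A \<and> tds_sound D C \<epsilon> \<delta> m n R A \<and> tds_complete D C \<delta> m n R A"

lemma space_std_gaussian: "space (std_gaussian d) = {..<d} \<rightarrow>\<^sub>E UNIV"
  by (simp add: std_gaussian_def space_PiM)

lemma prob_space_std_gaussian: "prob_space (std_gaussian d)"
  unfolding std_gaussian_def by (intro prob_space_PiM prob_space_normal_density) simp

lemma sets_std_gaussian: "sets (std_gaussian d) = sets (\<Pi>\<^sub>M i\<in>{..<d}. borel)"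
  unfolding std_gaussian_def by (intro sets_PiM_cong) auto

lemma sets_tds_experiment:
  assumes "sets D' = sets D"
  shows "sets (tds_experiment D D' f m n R) = sets (tds_inputs D m n R)"
  unfolding tds_experiment_def tds_inputs_def labelled_def
  by (intro sets_pair_measure_cong sets_PiM_cong) (auto simp: assms)

lemma tds_accept_event:
  assumes A: "tds_algorithm D m n R A" and ne: "space D \<noteq> {}"
  shows "{z \<in> space (tds_inputs D m n R). A z \<noteq> None} \<in> sets (tds_inputs D m n R)"
proof -
  let ?I = "tds_inputs D m n R"
  let ?g = "\<lambda>(z, x). case A z of None \<Rightarrow> 0 | Some h \<Rightarrow> h x"
  obtain x where x: "x \<in> space D" using ne by blast
  have G: "?g \<in> measurable (?I \<Otimes>\<^sub>M D) (count_space {- 1, 0, 1})"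
    using A unfolding tds_algorithm_def by blast
  have g: "(\<lambda>z. ?g (z, x)) \<in> measurable ?I (count_space {- 1, 0, 1})"
    by (rule measurable_compose[OF measurable_Pair2'[OF x] G])
  have "h x = - 1 \<or> h x = 1" if "z \<in> space ?I" "A z = Some h" for z h
    using A x that unfolding tds_algorithm_def by (fastforce dest: measurable_space)
  then have "{z \<in> space ?I. A z \<noteq> None} = (\<lambda>z. ?g (z, x)) -` {- 1, 1} \<inter> space ?I"
    by (auto split: option.splits)
  then show ?thesis using measurable_sets[OF g, of "{- 1, 1}"] by simp
qed

lemma tds_sound_event:
  assumes A: "tds_algorithm D m n R A" and D': "prob_space D'" "sets D' = sets D"
    and f: "f \<in> measurable D labels"
  shows "{z \<in> space (tds_experiment D D' f m n R). \<forall>h. A z = Some h \<longrightarrow> \<P>(x in D'. h x \<noteq> f x) \<le> \<epsilon>}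
    \<in> sets (tds_experiment D D' f m n R)"
proof -
  interpret D': prob_space D' by fact
  let ?I = "tds_inputs D m n R"
  let ?g = "\<lambda>(z, x). case A z of None \<Rightarrow> 0 | Some h \<Rightarrow> h x"
  have I: "sets (tds_experiment D D' f m n R) = sets ?I"
    by (rule sets_tds_experiment) fact
  have sp: "space (tds_experiment D D' f m n R) = space ?I"
    by (rule sets_eq_imp_space_eq[OF I])
  have ne: "space D \<noteq> {}"
    using D'.not_empty sets_eq_imp_space_eq[OF D'(2)] by simp
  have "sets (?I \<Otimes>\<^sub>M D) = sets (?I \<Otimes>\<^sub>M D')"
    by (intro sets_pair_measure_cong) (simp_all add: D'(2))
  from measurable_cong_sets[OF this refl]
  have G: "?g \<in> measurable (?I \<Otimes>\<^sub>M D') (count_space {- 1, 0, 1})"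
    using A unfolding tds_algorithm_def by blast
  have G': "?g \<in> measurable (?I \<Otimes>\<^sub>M D') (count_space UNIV)"
    by (rule measurable_compose[OF G]) simp
  have f': "f \<in> measurable D' (count_space UNIV)"
    using measurable_compose[OF f, of "\<lambda>x. x" "count_space UNIV"]
    by (simp add: measurable_cong_sets[OF D'(2) refl])
  have F: "(\<lambda>p. f (snd p)) \<in> measurable (?I \<Otimes>\<^sub>M D') (count_space UNIV)"
    by (rule measurable_compose[OF measurable_snd f'])
  let ?Q = "{p \<in> space (?I \<Otimes>\<^sub>M D'). ?g p \<noteq> f (snd p)}"
  have Q: "?Q \<in> sets (?I \<Otimes>\<^sub>M D')"
    using G' F by measurable
  have e: "(\<lambda>z. measure D' (Pair z -` ?Q)) \<in> borel_measurable ?I"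
    using D'.measurable_emeasure_Pair[OF Q] unfolding measure_def by measurable
  have sec: "measure D' (Pair z -` ?Q) = \<P>(x in D'. h x \<noteq> f x)"
    if "z \<in> space ?I" "A z = Some h" for z h
    using that by (intro arg_cong[where f = "measure D'"]) (auto simp: space_pair_measure)
  have "{z \<in> space ?I. \<forall>h. A z = Some h \<longrightarrow> \<P>(x in D'. h x \<noteq> f x) \<le> \<epsilon>} =
      (space ?I - {z \<in> space ?I. A z \<noteq> None}) \<union>
      {z \<in> space ?I. measure D' (Pair z -` ?Q) \<le> \<epsilon>}"
    using sec by (auto simp del: vimage_Collect_eq)
  also have "\<dots> \<in> sets ?I"
    using tds_accept_event[OF A ne] e by measurable
  finally show ?thesis by (simp add: I sp)
qed

text \<open>Agreement with the library's \<^const>\<open>convex\<close> under any enumeration of coordinates.\<close>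

lemma convex_in_iff_convex:
  fixes b :: "'n::finite \<Rightarrow> nat"
  assumes b: "bij_betw b UNIV {..<d}" and K: "K \<subseteq> {..<d} \<rightarrow>\<^sub>E UNIV"
  shows "convex_in d K \<longleftrightarrow> convex ((\<lambda>x. (\<chi> j. x (b j)) :: real ^ 'n) ` K)"
proof -
  let ?\<phi> = "\<lambda>x. (\<chi> j. x (b j)) :: real ^ 'n"
  have bd: "b j < d" for j using b by (auto simp: bij_betw_def)
  have inj: "x = y" if "x \<in> {..<d} \<rightarrow>\<^sub>E UNIV" "y \<in> {..<d} \<rightarrow>\<^sub>E UNIV" "?\<phi> x = ?\<phi> y" for x y
  proof (rule PiE_ext[OF that(1,2)])
    fix i assume "i \<in> {..<d}"
    then obtain j where "i = b j" using b by (auto simp: bij_betw_def)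
    then show "x i = y i" using that(3) by (auto simp: vec_eq_iff)
  qed
  have comb: "?\<phi> (\<lambda>i\<in>{..<d}. u * x i + v * y i) = u *\<^sub>R ?\<phi> x + v *\<^sub>R ?\<phi> y" for u v x y
    by (simp add: vec_eq_iff bd)
  have mem: "(\<lambda>i\<in>{..<d}. u * x i + v * y i) \<in> K \<longleftrightarrow> u *\<^sub>R ?\<phi> x + v *\<^sub>R ?\<phi> y \<in> ?\<phi> ` K"
    for u v x y
  proof
    assume "u *\<^sub>R ?\<phi> x + v *\<^sub>R ?\<phi> y \<in> ?\<phi> ` K"
    then have "?\<phi> (\<lambda>i\<in>{..<d}. u * x i + v * y i) \<in> ?\<phi> ` K"
      unfolding comb .
    then obtain w where w: "?\<phi> (\<lambda>i\<in>{..<d}. u * x i + v * y i) = ?\<phi> w" "w \<in> K"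
      by (rule imageE)
    have "(\<lambda>i\<in>{..<d}. u * x i + v * y i) = w"
      using w K by (intro inj) auto
    then show "(\<lambda>i\<in>{..<d}. u * x i + v * y i) \<in> K" using w by simp
  next
    assume "(\<lambda>i\<in>{..<d}. u * x i + v * y i) \<in> K"
    then show "u *\<^sub>R ?\<phi> x + v *\<^sub>R ?\<phi> y \<in> ?\<phi> ` K"
      unfolding comb[symmetric] by (rule imageI)
  qed
  show ?thesis
    unfolding convex_in_def convex_def using K by (simp add: mem)
qed

end

theory Submission
  imports Defs
begin

text \<open>
  Let \<open>s\<^sub>1, \<dots>, s\<^sub>N\<close> be independent Gaussian points, \<open>N \<approx> 2 n\<^sup>2\<close>, and let the test distribution be
  uniform on them. By the birthday bound, \<open>n\<close> test samples are distinct with probability at least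
  \<open>1/2\<close>, and then they look like Gaussian ones; so, on average over \<open>s\<close>, a complete learner
  accepts with probability at least \<open>(1 - \<delta>) / 2\<close> when the truth is the whole space. Compare this
  truth with the polyhedron \<open>K = {x. \<forall>j. \<langle>s\<^sub>j, x\<rangle> < d/2}\<close>. Since \<open>|s\<^sub>j|\<^sup>2\<close> concentrates around \<open>d\<close> while
  inner products of independent Gaussian points are much smaller, \<open>K\<close> contains all training points
  but no \<open>s\<^sub>j\<close> with high probability, so the learner sees the same input for both truths, whose
  labels disagree on the whole support of the test distribution. Soundness for both truths then
  bounds the probability of acceptance by \<open>2 \<delta> + o(1)\<close>.
\<close>

section \<open>Gaussian integrals\<close>

text \<open>Completing the square: tilting the standard normal density by \<open>exp (a * x)\<close>
  gives \<open>exp (a\<^sup>2 / 2)\<close> times the normal density with mean \<open>a\<close>,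
  which has total mass 1.\<close>

lemma nn_integral_std_normal_exp_linear:
  "(\<integral>\<^sup>+ x. ennreal (exp (a * x)) \<partial>density lborel std_normal_density) = ennreal (exp (a\<^sup>2 / 2))"
proof -
  have eq: "std_normal_density x * exp (a * x) = exp (a\<^sup>2 / 2) * normal_density a 1 x" for x
    by (simp add: normal_density_def exp_add[symmetric] power2_eq_square field_simps)
  have "(\<integral>\<^sup>+ x. ennreal (exp (a * x)) \<partial>density lborel std_normal_density)
      = (\<integral>\<^sup>+ x. ennreal (exp (a\<^sup>2 / 2)) * ennreal (normal_density a 1 x) \<partial>lborel)"
    by (subst nn_integral_density) (simp_all add: ennreal_mult'[symmetric] eq)
  also have "\<dots> = ennreal (exp (a\<^sup>2 / 2)) * emeasure (density lborel (normal_density a 1)) UNIV"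
    by (subst nn_integral_cmult) (simp_all add: emeasure_density)
  finally show ?thesis
    using prob_space.emeasure_space_1[OF prob_space_normal_density[of 1 a]] by simp
qed

text \<open>For \<open>b < 1 / 2\<close> the tilted density is still Gaussian up to a factor:
  centred, with variance \<open>1 / (1 - 2 * b)\<close>. The factor is its standard
  deviation.\<close>

lemma nn_integral_std_normal_exp_square:
  assumes "b < 1 / 2"
  shows "(\<integral>\<^sup>+ x. ennreal (exp (b * x\<^sup>2)) \<partial>density lborel std_normal_density)
    = ennreal (1 / sqrt (1 - 2 * b))"
proof -
  define \<sigma> where "\<sigma> = 1 / sqrt (1 - 2 * b)"
  have \<sigma>: "\<sigma> > 0" "\<sigma>\<^sup>2 = 1 / (1 - 2 * b)"
    using assms by (simp_all add: \<sigma>_def power_divide)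
  have "- (x\<^sup>2) / (2 * \<sigma>\<^sup>2) = - (x\<^sup>2) / 2 + b * x\<^sup>2" for x
    using assms by (simp add: \<sigma>(2) field_simps)
  then have eq: "std_normal_density x * exp (b * x\<^sup>2) = \<sigma> * normal_density 0 \<sigma> x" for x
    using \<sigma>(1) by (simp add: normal_density_def exp_add[symmetric] real_sqrt_mult)
  have "(\<integral>\<^sup>+ x. ennreal (exp (b * x\<^sup>2)) \<partial>density lborel std_normal_density)
      = (\<integral>\<^sup>+ x. ennreal \<sigma> * ennreal (normal_density 0 \<sigma> x) \<partial>lborel)"
    using \<sigma>(1) by (subst nn_integral_density) (simp_all add: ennreal_mult'[symmetric] eq)
  also have "\<dots> = ennreal \<sigma> * emeasure (density lborel (normal_density 0 \<sigma>)) UNIV"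
    by (subst nn_integral_cmult) (simp_all add: emeasure_density)
  finally show ?thesis
    using prob_space.emeasure_space_1[OF prob_space_normal_density[of \<sigma> 0]] \<sigma>(1)
    by (simp add: \<sigma>_def)
qed

lemma nn_integral_std_gaussian_prod:
  assumes "\<And>i. i < d \<Longrightarrow> f i \<in> borel_measurable borel"
  shows "(\<integral>\<^sup>+ x. (\<Prod>i<d. f i (x i)) \<partial>std_gaussian d)
    = (\<Prod>i<d. \<integral>\<^sup>+ y. f i y \<partial>density lborel std_normal_density)"
proof -
  interpret prob_space "density lborel std_normal_density"
    by (rule prob_space_normal_density) simp
  interpret product_sigma_finite "\<lambda>_::nat. density lborel std_normal_density"
    by standard
  show ?thesis
    unfolding std_gaussian_def by (rule product_nn_integral_prod) (use assms in auto)
qed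

lemma nn_integral_std_gaussian_exp_linear:
  "(\<integral>\<^sup>+ x. ennreal (exp (\<Sum>i<d. a i * x i)) \<partial>std_gaussian d) = ennreal (exp (\<Sum>i<d. (a i)\<^sup>2 / 2))"
  using nn_integral_std_gaussian_prod[of d "\<lambda>i y. ennreal (exp (a i * y))"]
  by (simp add: exp_sum prod_ennreal nn_integral_std_normal_exp_linear)

lemma nn_integral_std_gaussian_exp_square:
  assumes "b < 1 / 2"
  shows "(\<integral>\<^sup>+ x. ennreal (exp (\<Sum>i<d. b * (x i)\<^sup>2)) \<partial>std_gaussian d)
    = ennreal ((1 / sqrt (1 - 2 * b)) ^ d)"
  using nn_integral_std_gaussian_prod[of d "\<lambda>i y. ennreal (exp (b * y\<^sup>2))"] assms
  by (simp add: exp_sum prod_ennreal nn_integral_std_normal_exp_square ennreal_power)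

lemma measurable_component_std_gaussian [measurable]:
  "i < d \<Longrightarrow> (\<lambda>x. x i) \<in> borel_measurable (std_gaussian d)"
  unfolding std_gaussian_def by measurable

text \<open>Chernoff bound: on the half-space the indicator is at most
  \<open>exp (t * (\<langle>v, x\<rangle> - c))\<close>, whose mean is the linear exponential
  moment. The parameter \<open>t\<close> stays free; it is set to \<open>1 / 2\<close> for
  \<open>c = d / 2\<close> below.\<close>

lemma emeasure_std_gaussian_halfspace_le:
  "emeasure (std_gaussian d) {x \<in> space (std_gaussian d). c \<le> (\<Sum>i<d. v i * x i)}
    \<le> ennreal (exp (- t * c) * exp (\<Sum>i<d. (t * v i)\<^sup>2 / 2))" if "t \<ge> 0"
proof -
  let ?S = "{x \<in> space (std_gaussian d). c \<le> (\<Sum>i<d. v i * x i)}"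
  have S: "?S \<in> sets (std_gaussian d)" by measurable
  have "indicator ?S x \<le> ennreal (exp (- t * c)) * ennreal (exp (\<Sum>i<d. t * v i * x i))" for x
  proof (cases "x \<in> ?S")
    case True
    then have "0 \<le> t * ((\<Sum>i<d. v i * x i) - c)" using that by simp
    also have "\<dots> = - t * c + (\<Sum>i<d. t * v i * x i)"
      by (simp add: algebra_simps sum_distrib_left)
    finally have "1 \<le> exp (- t * c) * exp (\<Sum>i<d. t * v i * x i)"
      by (simp add: exp_add[symmetric])
    then show ?thesis using True by (simp add: ennreal_mult'[symmetric])
  qed simp
  then have "(\<integral>\<^sup>+ x. indicator ?S x \<partial>std_gaussian d) \<le>
      (\<integral>\<^sup>+ x. ennreal (exp (- t * c)) * ennreal (exp (\<Sum>i<d. t * v i * x i)) \<partial>std_gaussian d)"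
    by (intro nn_integral_mono)
  also have "\<dots> = ennreal (exp (- t * c)) * ennreal (exp (\<Sum>i<d. (t * v i)\<^sup>2 / 2))"
    by (subst nn_integral_cmult) (auto simp: nn_integral_std_gaussian_exp_linear)
  finally show ?thesis using S by (simp add: ennreal_mult')
qed

section \<open>Indistinguishable truths\<close>

lemma prob_space_labelled:
  assumes "prob_space D" "f \<in> measurable D labels"
  shows "prob_space (labelled D f)"
  unfolding labelled_def
  by (rule prob_space.prob_space_distr[OF assms(1)]) (use assms(2) in measurable)

lemma prob_space_tds_experiment:
  assumes "prob_space D" "prob_space D'" "prob_space R" "f \<in> measurable D labels"
  shows "prob_space (tds_experiment D D' f m n R)"
  unfolding tds_experiment_def
  by (intro prob_space_pair prob_space_PiM prob_space_labelled assms)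

text \<open>The points can be drawn first and labelled afterwards, coordinate by coordinate, so the
  truth enters only through a deterministic map.\<close>

lemma PiM_labelled:
  fixes m :: nat
  assumes D: "prob_space D" and f: "f \<in> measurable D labels"
  shows "(\<Pi>\<^sub>M i\<in>{..<m}. labelled D f)
    = distr (\<Pi>\<^sub>M i\<in>{..<m}. D) (\<Pi>\<^sub>M i\<in>{..<m}. D \<Otimes>\<^sub>M labels) (compose {..<m} (\<lambda>x. (x, f x)))"
proof -
  have [measurable]: "(\<lambda>x. (x, f x)) \<in> measurable D (D \<Otimes>\<^sub>M labels)" using f by measurable
  have L: "prob_space (labelled D f)"
    by (rule prob_space_labelled[OF D f])
  have "(\<Pi>\<^sub>M i\<in>{..<m}. labelled D f)
     = (\<Pi>\<^sub>M i\<in>{..<m}. distr D (labelled D f) (\<lambda>x. (x, f x)))"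
    by (intro PiM_cong refl) (simp add: labelled_def cong: distr_cong)
  also have "\<dots> = distr (\<Pi>\<^sub>M i\<in>{..<m}. D) (\<Pi>\<^sub>M i\<in>{..<m}. labelled D f) (compose {..<m} (\<lambda>x. (x, f x)))"
    by (rule distr_PiM_finite_prob_space'[symmetric]) (use D L in \<open>auto simp: labelled_def\<close>)
  also have "\<dots> = distr (\<Pi>\<^sub>M i\<in>{..<m}. D) (\<Pi>\<^sub>M i\<in>{..<m}. D \<Otimes>\<^sub>M labels) (compose {..<m} (\<lambda>x. (x, f x)))"
    by (intro distr_cong sets_PiM_cong) (auto simp: labelled_def)
  finally show ?thesis .
qed

lemma measurable_label_sample:
  assumes f: "f \<in> measurable D labels"
  shows "compose {..<m} (\<lambda>x. (x, f x)) \<in> measurable (\<Pi>\<^sub>M i\<in>{..<m}. D) (\<Pi>\<^sub>M i\<in>{..<m}. D \<Otimes>\<^sub>M labels)"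
  unfolding compose_def using f by measurable

text \<open>This is the coupling: for fixed \<open>D'\<close>, the experiments for all truths live
  on one probability space of unlabelled points and seed, and two truths can be compared outcome by
  outcome.\<close>

lemma tds_experiment_eq_distr:
  assumes D: "prob_space D" and D': "prob_space D'" "sets D' = sets D" and R: "prob_space R"
    and f: "f \<in> measurable D labels"
  shows "tds_experiment D D' f m n R
    = distr ((\<Pi>\<^sub>M i\<in>{..<m}. D) \<Otimes>\<^sub>M (\<Pi>\<^sub>M i\<in>{..<n}. D') \<Otimes>\<^sub>M R) (tds_inputs D m n R)
        (\<lambda>(x, p). (compose {..<m} (\<lambda>x. (x, f x)) x, p))"
proof -
  let ?T = "(\<Pi>\<^sub>M i\<in>{..<n}. D') \<Otimes>\<^sub>M R"
  interpret T: prob_space ?T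
    by (intro prob_space_pair prob_space_PiM D' R)
  \<comment> \<open>Test sample and seed are written as a push-forward under the identity, so that
    the product of two push-forwards can be merged into one.\<close>
  have "tds_experiment D D' f m n R =
    distr (\<Pi>\<^sub>M i\<in>{..<m}. D) (\<Pi>\<^sub>M i\<in>{..<m}. D \<Otimes>\<^sub>M labels) (compose {..<m} (\<lambda>x. (x, f x)))
      \<Otimes>\<^sub>M distr ?T ?T (\<lambda>p. p)"
    unfolding tds_experiment_def PiM_labelled[OF D f] by simp
  also have "\<dots> = distr ((\<Pi>\<^sub>M i\<in>{..<m}. D) \<Otimes>\<^sub>M ?T) ((\<Pi>\<^sub>M i\<in>{..<m}. D \<Otimes>\<^sub>M labels) \<Otimes>\<^sub>M ?T)
      (\<lambda>(x, p). (compose {..<m} (\<lambda>x. (x, f x)) x, p))"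
    by (rule pair_measure_distr) (use f measurable_label_sample T.sigma_finite_measure in auto)
  also have "\<dots> = distr ((\<Pi>\<^sub>M i\<in>{..<m}. D) \<Otimes>\<^sub>M ?T) (tds_inputs D m n R)
      (\<lambda>(x, p). (compose {..<m} (\<lambda>x. (x, f x)) x, p))"
    unfolding tds_inputs_def
    by (intro distr_cong sets_pair_measure_cong sets_PiM_cong refl D')
  finally show ?thesis .
qed


text \<open>Run the learner on coupled samples for the truths \<open>f\<close> and \<open>g\<close>.
  If no training point lies where they differ, the two inputs coincide. An accepted hypothesis
  cannot then be \<epsilon>-close to both truths under \<open>D'\<close>, as they are more than
  \<open>2 * \<epsilon>\<close> apart; so soundness fails for one of them. The union bound adds
  \<delta> for each truth and one term for each training point.\<close>

lemma tds_accept_prob_le: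
  fixes D :: "'x measure" and R :: "'r measure"
  assumes L: "tds_learner D C \<epsilon> \<delta> m n R A" and D: "prob_space D"
    and D': "prob_space D'" "sets D' = sets D"
    and f: "f \<in> C" "f \<in> measurable D labels" and g: "g \<in> C" "g \<in> measurable D labels"
    and far: "\<P>(x in D'. f x \<noteq> g x) > 2 * \<epsilon>"
  shows "\<P>(z in tds_experiment D D' f m n R. A z \<noteq> None) \<le> 2 * \<delta> + real m * \<P>(x in D. f x \<noteq> g x)"
proof -
  have A: "tds_algorithm D m n R A" and snd: "tds_sound D C \<epsilon> \<delta> m n R A"
    using L by (auto simp: tds_learner_def)
  have R: "prob_space R" using A by (simp add: tds_algorithm_def)
  interpret D: prob_space D by fact
  interpret D': prob_space D' by fact
  let ?I = "tds_inputs D m n R"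
  let ?X = "\<Pi>\<^sub>M i\<in>{..<m}. D"
  let ?\<Omega> = "?X \<Otimes>\<^sub>M (\<Pi>\<^sub>M i\<in>{..<n}. D') \<Otimes>\<^sub>M R"
  interpret X: prob_space ?X by (intro prob_space_PiM D)
  interpret TR: prob_space "(\<Pi>\<^sub>M i\<in>{..<n}. D') \<Otimes>\<^sub>M R" by (intro prob_space_pair prob_space_PiM D' R)
  interpret \<Omega>: prob_space ?\<Omega> by (intro prob_space_pair prob_space_PiM D D' R)
  \<comment> \<open>\<open>\<phi> u\<close> labels the shared training points by \<open>u\<close>;
    \<open>E u\<close> below is the soundness event for the truth \<open>u\<close>.\<close>
  define \<phi> :: "('x \<Rightarrow> int) \<Rightarrow> (nat \<Rightarrow> 'x) \<times> (nat \<Rightarrow> 'x) \<times> 'r \<Rightarrow> ('x, 'r) tds_input" where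
    "\<phi> u = (\<lambda>(x, p). (compose {..<m} (\<lambda>y. (y, u y)) x, p))" for u
  define E where
    "E u = {z \<in> space ?I. \<forall>h. A z = Some h \<longrightarrow> \<P>(x in D'. h x \<noteq> u x) \<le> \<epsilon>}" for u
  define Acc where "Acc = {z \<in> space ?I. A z \<noteq> None}"
  have expt: "tds_experiment D D' u m n R = distr ?\<Omega> ?I (\<phi> u)" if "u \<in> measurable D labels" for u
    unfolding \<phi>_def by (rule tds_experiment_eq_distr[OF D D' R that])
  have sp: "space (tds_experiment D D' u m n R) = space ?I" for u
    by (rule sets_eq_imp_space_eq[OF sets_tds_experiment[OF D'(2)]])
  have I: "sets ((\<Pi>\<^sub>M i\<in>{..<m}. D \<Otimes>\<^sub>M labels) \<Otimes>\<^sub>M (\<Pi>\<^sub>M i\<in>{..<n}. D') \<Otimes>\<^sub>M R) = sets ?I"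
    unfolding tds_inputs_def by (intro sets_pair_measure_cong sets_PiM_cong refl D')
  have \<phi>: "\<phi> u \<in> measurable ?\<Omega> ?I" if "u \<in> measurable D labels" for u
    unfolding \<phi>_def measurable_cong_sets[OF refl I[symmetric]]
    using measurable_label_sample[OF that, of m] by measurable
  have Acc: "Acc \<in> sets ?I"
    unfolding Acc_def by (rule tds_accept_event[OF A D.not_empty])
  have E: "E u \<in> sets ?I" if "u \<in> measurable D labels" for u
    using tds_sound_event[OF A D' that, of \<epsilon>] unfolding E_def sp sets_tds_experiment[OF D'(2)] .
  have out: "\<Omega>.prob (\<phi> u -` (space ?I - E u) \<inter> space ?\<Omega>) \<le> \<delta>"
    if u: "u \<in> C" "u \<in> measurable D labels" for u
  proof -
    interpret P: prob_space "distr ?\<Omega> ?I (\<phi> u)"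
      by (rule \<Omega>.prob_space_distr[OF \<phi>[OF u(2)]])
    have "1 - \<delta> \<le> \<P>(z in tds_experiment D D' u m n R.
        \<forall>h. A z = Some h \<longrightarrow> \<P>(x in D'. h x \<noteq> u x) \<le> \<epsilon>)"
      using snd u D' unfolding tds_sound_def by blast
    then have "1 - \<delta> \<le> P.prob (E u)"
      unfolding E_def sp by (simp only: expt[OF u(2)])
    moreover have "P.prob (space ?I - E u) = 1 - P.prob (E u)"
      using P.prob_compl[of "E u"] E[OF u(2)] by simp
    ultimately have "P.prob (space ?I - E u) \<le> \<delta>" by linarith
    then show ?thesis
      using E[OF u(2)] by (subst (asm) measure_distr[OF \<phi>[OF u(2)]]) auto
  qed
  \<comment> \<open>The \<open>i\<close>-th training point reveals which of the two truths is in
    force.\<close>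
  define B where "B i = {\<omega> \<in> space ?\<Omega>. f (fst \<omega> i) \<noteq> g (fst \<omega> i)}" for i
  have fg: "{x \<in> space D. f x \<noteq> g x} \<in> sets D"
  proof -
    have [measurable]: "f \<in> measurable D (count_space UNIV)" "g \<in> measurable D (count_space UNIV)"
      using measurable_compose[OF f(2), of "\<lambda>x. x" "count_space UNIV"]
        measurable_compose[OF g(2), of "\<lambda>x. x" "count_space UNIV"] by simp_all
    show ?thesis by measurable
  qed
  have comp: "(\<lambda>\<omega>. fst \<omega> i) \<in> measurable ?\<Omega> D" if "i < m" for i
    by (rule measurable_compose[OF measurable_fst measurable_component_singleton]) (use that in simp)
  have Bpre: "B i = (\<lambda>\<omega>. fst \<omega> i) -` {x \<in> space D. f x \<noteq> g x} \<inter> space ?\<Omega>" if "i < m" for i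
    using measurable_space[OF comp[OF that]] by (auto simp: B_def)
  have B: "B i \<in> sets ?\<Omega>" if "i < m" for i
    unfolding Bpre[OF that] using comp[OF that] fg by (rule measurable_sets)
  have PB: "\<Omega>.prob (B i) = \<P>(x in D. f x \<noteq> g x)" if "i < m" for i
  proof -
    have "distr ?\<Omega> D (\<lambda>\<omega>. fst \<omega> i) = distr (distr ?\<Omega> ?X fst) D (\<lambda>x. x i)"
      using that by (subst distr_distr) (auto simp: comp_def)
    also have "distr ?\<Omega> ?X fst = ?X"
      by (rule TR.distr_pair_fst)
    also have "distr ?X D (\<lambda>x. x i) = D"
      by (rule distr_PiM_component) (use that D in auto)
    finally show ?thesis
      unfolding Bpre[OF that] using measure_distr[OF comp[OF that] fg] by simp
  qed
  have same: "\<phi> f \<omega> = \<phi> g \<omega>" if "\<omega> \<in> space ?\<Omega>" "\<omega> \<notin> (\<Union>i<m. B i)" for \<omega>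
    using that by (auto simp: \<phi>_def B_def compose_def restrict_def split: prod.split)
  \<comment> \<open>Triangle inequality for disagreement: wherever \<open>f\<close> and
    \<open>g\<close> differ, the output \<open>h\<close> differs from at least one of them.\<close>
  have disj: "z \<notin> E f \<or> z \<notin> E g" if z: "z \<in> Acc" for z
  proof (rule ccontr)
    assume *: "\<not> (z \<notin> E f \<or> z \<notin> E g)"
    from z obtain h where h: "A z = Some h" "z \<in> space ?I" by (auto simp: Acc_def)
    then have hm: "h \<in> measurable D labels" using A by (auto simp: tds_algorithm_def)
    have [measurable]: "u \<in> measurable D' (count_space UNIV)" if "u \<in> measurable D labels" for u
      using measurable_compose[OF that, of "\<lambda>x. x" "count_space UNIV"]
      by (simp add: measurable_cong_sets[OF D'(2) refl])
    note [measurable] = f(2) g(2) hm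
    have "\<P>(x in D'. f x \<noteq> g x) \<le> D'.prob ({x \<in> space D'. h x \<noteq> f x} \<union> {x \<in> space D'. h x \<noteq> g x})"
      by (rule D'.finite_measure_mono) (auto, measurable)
    also have "\<dots> \<le> \<P>(x in D'. h x \<noteq> f x) + \<P>(x in D'. h x \<noteq> g x)"
      by (rule measure_Un_le; measurable)
    also have "\<dots> \<le> 2 * \<epsilon>" using * h by (auto simp: E_def)
    finally show False using far by simp
  qed
  let ?F = "\<phi> f -` (space ?I - E f) \<inter> space ?\<Omega>" and ?G = "\<phi> g -` (space ?I - E g) \<inter> space ?\<Omega>"
  have FG: "?F \<in> sets ?\<Omega>" "?G \<in> sets ?\<Omega>"
    using \<phi> E f g by (auto intro!: measurable_sets[where A = ?I] sets.compl_sets)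
  have BU: "(\<Union>i<m. B i) \<in> sets ?\<Omega>" using B by auto
  have "\<P>(z in tds_experiment D D' f m n R. A z \<noteq> None) = \<Omega>.prob (\<phi> f -` Acc \<inter> space ?\<Omega>)"
    using measure_distr[OF \<phi>[OF f(2)] Acc] unfolding Acc_def expt[OF f(2)] space_distr .
  also have "\<dots> \<le> \<Omega>.prob (?F \<union> ?G \<union> (\<Union>i<m. B i))"
  proof (rule \<Omega>.finite_measure_mono)
    show "\<phi> f -` Acc \<inter> space ?\<Omega> \<subseteq> ?F \<union> ?G \<union> (\<Union>i<m. B i)"
    proof
      fix \<omega> assume \<omega>: "\<omega> \<in> \<phi> f -` Acc \<inter> space ?\<Omega>"
      then show "\<omega> \<in> ?F \<union> ?G \<union> (\<Union>i<m. B i)"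
        using disj[of "\<phi> f \<omega>"] same[of \<omega>] by (auto simp: Acc_def)
    qed
  qed (use FG BU in auto)
  also have "\<dots> \<le> \<Omega>.prob ?F + \<Omega>.prob ?G + \<Omega>.prob (\<Union>i<m. B i)"
    using measure_Un_le[of "?F \<union> ?G" ?\<Omega> "\<Union>i<m. B i"] measure_Un_le[OF FG] FG BU by auto
  also have "\<Omega>.prob (\<Union>i<m. B i) \<le> (\<Sum>i<m. \<Omega>.prob (B i))"
    by (rule \<Omega>.finite_measure_subadditive_finite) (use B in auto)
  also have "\<dots> = real m * \<P>(x in D. f x \<noteq> g x)"
    using PB by simp
  also have "\<Omega>.prob ?F \<le> \<delta>" using f by (rule out)
  also have "\<Omega>.prob ?G \<le> \<delta>" using g by (rule out)
  finally show ?thesis by simp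
qed

section \<open>Empirical test distributions\<close>

text \<open>Sampling means choosing an index uniformly, so repeated points count with multiplicity
  and collisions can be studied on indices, independently of \<open>s\<close>.\<close>

definition empirical :: "'x measure \<Rightarrow> nat \<Rightarrow> (nat \<Rightarrow> 'x) \<Rightarrow> 'x measure" where
  "empirical D N s = distr (uniform_count_measure {..<N}) D s"

lemma
  assumes "s \<in> space (\<Pi>\<^sub>M j\<in>{..<N}. D)" "N > 0"
  shows measurable_empirical: "s \<in> measurable (uniform_count_measure {..<N}) D"
    and prob_space_empirical: "prob_space (empirical D N s)"
    and sets_empirical: "sets (empirical D N s) = sets D"
proof -
  show *: "s \<in> measurable (uniform_count_measure {..<N}) D"
    using assms(1)
    by (auto simp: measurable_cong_sets[OF sets_uniform_count_measure_count_space refl] space_PiM)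
  show "prob_space (empirical D N s)"
    unfolding empirical_def
    by (intro prob_space.prob_space_distr[OF _ *] prob_space_uniform_count_measure)
       (use assms(2) in auto)
  show "sets (empirical D N s) = sets D"
    by (simp add: empirical_def)
qed

lemma prob_empirical_eq_1:
  assumes s: "s \<in> space (\<Pi>\<^sub>M j\<in>{..<N}. D)" and N: "N > 0"
    and P: "{x \<in> space D. P x} \<in> sets D" "\<And>j. j < N \<Longrightarrow> P (s j)"
  shows "\<P>(x in empirical D N s. P x) = 1"
proof -
  interpret U: prob_space "uniform_count_measure {..<N}"
    by (rule prob_space_uniform_count_measure) (use N in auto)
  have "\<P>(x in empirical D N s. P x)
      = U.prob (s -` {x \<in> space D. P x} \<inter> space (uniform_count_measure {..<N}))"
    unfolding empirical_def space_distr by (rule measure_distr[OF measurable_empirical[OF s N] P(1)])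
  also have "s -` {x \<in> space D. P x} \<inter> space (uniform_count_measure {..<N})
      = space (uniform_count_measure {..<N})"
    using measurable_space[OF measurable_empirical[OF s N]] P(2)
    by (auto simp: space_uniform_count_measure)
  finally show ?thesis by (simp add: U.prob_space)
qed

lemma PiM_empirical:
  fixes n :: nat
  assumes s: "s \<in> space (\<Pi>\<^sub>M j\<in>{..<N}. D)" and N: "N > 0" and D: "prob_space D"
  shows "(\<Pi>\<^sub>M i\<in>{..<n}. empirical D N s)
    = distr (\<Pi>\<^sub>M i\<in>{..<n}. uniform_count_measure {..<N}) (\<Pi>\<^sub>M i\<in>{..<n}. D) (compose {..<n} s)"
  unfolding empirical_def
  by (rule distr_PiM_finite_prob_space'[symmetric])
     (use N D measurable_empirical[OF s N] in \<open>auto intro!: prob_space_uniform_count_measure\<close>)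

text \<open>Birthday bound: there are at most \<open>n\<^sup>2\<close> ordered pairs of distinct
  positions and \<open>N\<close> possible common values, and each such collision has probability
  \<open>1 / N\<^sup>2\<close>.\<close>

lemma prob_uniform_inj_ge:
  fixes N n :: nat
  assumes N: "N > 0"
  shows "\<P>(k in (\<Pi>\<^sub>M i\<in>{..<n}. uniform_count_measure {..<N}). inj_on k {..<n}) \<ge> 1 - real n ^ 2 / real N"
proof -
  let ?U = "uniform_count_measure {..<N}" and ?M = "\<Pi>\<^sub>M i\<in>{..<n}. uniform_count_measure {..<N}"
  have U: "prob_space ?U" by (rule prob_space_uniform_count_measure) (use N in auto)
  interpret M: prob_space ?M by (intro prob_space_PiM U)
  interpret U: product_prob_space "\<lambda>_::nat. ?U" "{..<n}"
    using U by (auto simp: product_prob_space_def product_prob_space_axioms_def product_sigma_finite_def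
        prob_space_imp_sigma_finite)
  define S where "S = {p \<in> {..<n} \<times> {..<n}. fst p \<noteq> snd p}"
  have Sfin: "finite S" by (auto simp: S_def)
  have Scard: "card S \<le> n\<^sup>2"
    using card_mono[of "{..<n} \<times> {..<n}" S] by (auto simp: S_def power2_eq_square)
  \<comment> \<open>A collision with a prescribed value is a cylinder over two coordinates, so its
    measure is a product.\<close>
  define Q where "Q p v = {k \<in> space ?M. \<forall>i\<in>{fst p, snd p}. k i \<in> {v}}" for p :: "nat \<times> nat" and v
  have v: "{v} \<in> sets ?U" if "v < N" for v using that by (simp add: sets_uniform_count_measure)
  have comp: "(\<lambda>k. k i) \<in> measurable ?M ?U" if "i < n" for i
    by (rule measurable_component_singleton) (use that in simp)
  have Qs: "Q p v \<in> sets ?M" if "p \<in> S" "v < N" for p v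
  proof -
    have "{k \<in> space ?M. k i \<in> {v}} \<in> sets ?M" if "i < n" for i
      using measurable_sets[OF comp[OF that] v[OF \<open>v < N\<close>]] by (simp add: vimage_def Int_def conj_commute)
    then show ?thesis using that(1) unfolding Q_def S_def
      by (intro sets.sets_Collect_finite_All') auto
  qed
  have Qp: "M.prob (Q p v) = 1 / real N ^ 2" if "p \<in> S" "v < N" for p v
  proof -
    have "emeasure ?M (Q p v) = (\<Prod>i\<in>{fst p, snd p}. emeasure ?U {v})"
      unfolding Q_def by (rule U.emeasure_PiM_Collect) (use that v in \<open>auto simp: S_def\<close>)
    also have "\<dots> = ennreal (1 / real N) ^ 2"
      using that by (simp add: S_def emeasure_uniform_count_measure power2_eq_square)
    finally show ?thesis
      by (simp add: measure_def ennreal_power power_divide)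
  qed
  have sub: "space ?M - {k \<in> space ?M. inj_on k {..<n}} \<subseteq> (\<Union>p\<in>S. \<Union>v<N. Q p v)"
  proof
    fix k assume "k \<in> space ?M - {k \<in> space ?M. inj_on k {..<n}}"
    then obtain a b where k: "k \<in> space ?M" and ab: "a < n" "b < n" "a \<noteq> b" "k a = k b"
      by (auto simp: inj_on_def)
    then have "k a < N" by (auto simp: space_PiM space_uniform_count_measure)
    then have "(a, b) \<in> S" "k a \<in> {..<N}" "k \<in> Q (a, b) (k a)" using k ab by (auto simp: S_def Q_def)
    then show "k \<in> (\<Union>p\<in>S. \<Union>v<N. Q p v)" by blast
  qed
  have inj: "{k \<in> space ?M. inj_on k {..<n}} = space ?M - (\<Union>p\<in>S. \<Union>v<N. Q p v)"
    using sub by (auto simp: Q_def S_def inj_on_def)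
  have QU: "(\<Union>p\<in>S. \<Union>v<N. Q p v) \<in> sets ?M" using Sfin Qs by auto
  have "M.prob (\<Union>p\<in>S. \<Union>v<N. Q p v) \<le> (\<Sum>p\<in>S. M.prob (\<Union>v<N. Q p v))"
    by (rule M.finite_measure_subadditive_finite) (use Sfin Qs in auto)
  also have "\<dots> \<le> (\<Sum>p\<in>S. \<Sum>v<N. M.prob (Q p v))"
    by (intro sum_mono M.finite_measure_subadditive_finite) (use Qs in auto)
  also have "\<dots> = real (card S) / real N"
    using Qp N by (simp add: power2_eq_square)
  also have "\<dots> \<le> real n ^ 2 / real N"
    using Scard N by (intro divide_right_mono) (simp_all flip: of_nat_power)
  finally show ?thesis unfolding inj using M.prob_compl[OF QU] by simp
qed

text \<open>Integrate over \<open>s\<close> with the indices \<open>k\<close> fixed. For injective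
  \<open>k\<close> the chosen points are \<open>n\<close> distinct coordinates of \<open>s\<close>,
  hence i.i.d. from \<open>D\<close>, and the integral is exactly the one under \<open>D\<close>.
  Other \<open>k\<close> are discarded, which is allowed because \<open>q\<close> is
  nonnegative.\<close>

lemma nn_integral_empirical_ge:
  fixes D :: "'x measure"
  assumes D: "prob_space D" and N: "N > 0"
    and q: "q \<in> borel_measurable (\<Pi>\<^sub>M i\<in>{..<n}. D)"
  shows "ennreal (1 - real n ^ 2 / real N) * (\<integral>\<^sup>+ t. q t \<partial>(\<Pi>\<^sub>M i\<in>{..<n}. D))
    \<le> (\<integral>\<^sup>+ s. (\<integral>\<^sup>+ t. q t \<partial>(\<Pi>\<^sub>M i\<in>{..<n}. empirical D N s)) \<partial>(\<Pi>\<^sub>M j\<in>{..<N}. D))"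
proof -
  let ?U = "uniform_count_measure {..<N}" and ?M = "\<Pi>\<^sub>M i\<in>{..<n}. uniform_count_measure {..<N}"
  let ?S = "\<Pi>\<^sub>M j\<in>{..<N}. D" and ?T = "\<Pi>\<^sub>M i\<in>{..<n}. D"
  have U: "prob_space ?U" by (rule prob_space_uniform_count_measure) (use N in auto)
  interpret M: prob_space ?M by (intro prob_space_PiM U)
  interpret S: prob_space ?S by (intro prob_space_PiM D)
  interpret SM: pair_sigma_finite ?S ?M by standard
  \<comment> \<open>The index vectors form a finite discrete space, so joint measurability in
    \<open>(s, k)\<close> reduces to measurability in \<open>s\<close> for each fixed
    \<open>k\<close>.\<close>
  have Mcs: "sets ?M = sets (count_space ({..<n} \<rightarrow>\<^sub>E {..<N}))"
    unfolding count_space_PiM_finite[of "{..<n}" "\<lambda>_. {..<N}", simplified, symmetric]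
    by (intro sets_PiM_cong refl sets_uniform_count_measure_count_space)
  have inner: "(\<integral>\<^sup>+ t. q t \<partial>(\<Pi>\<^sub>M i\<in>{..<n}. empirical D N s)) = (\<integral>\<^sup>+ k. q (compose {..<n} s k) \<partial>?M)"
    if s: "s \<in> space ?S" for s
  proof -
    have "compose {..<n} s \<in> measurable ?M ?T"
      unfolding compose_def
      by (intro measurable_restrict measurable_compose[OF _ measurable_empirical[OF s N]]
          measurable_component_singleton)
    from nn_integral_distr[OF this, of q] q show ?thesis
      unfolding PiM_empirical[OF s N D] by simp
  qed
  have meas: "(\<lambda>(s, k). q (compose {..<n} s k)) \<in> borel_measurable (?S \<Otimes>\<^sub>M ?M)"
  proof -
    have "(\<lambda>p. q (compose {..<n} (fst p) (snd p))) \<in> borel_measurable (?S \<Otimes>\<^sub>M ?M)"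
    proof (rule measurable_compose_countable'[where I = "{..<n} \<rightarrow>\<^sub>E {..<N}" and g = snd])
      fix k assume "k \<in> {..<n} \<rightarrow>\<^sub>E {..<N}"
      then have "(\<lambda>s. compose {..<n} s k) \<in> measurable ?S ?T"
        unfolding compose_def by (intro measurable_restrict measurable_component_singleton) auto
      then show "(\<lambda>p. q (compose {..<n} (fst p) k)) \<in> borel_measurable (?S \<Otimes>\<^sub>M ?M)"
        using q by (intro measurable_compose[OF measurable_fst] measurable_compose[OF _ q])
    next
      show "snd \<in> measurable (?S \<Otimes>\<^sub>M ?M) (count_space ({..<n} \<rightarrow>\<^sub>E {..<N}))"
        unfolding measurable_cong_sets[OF refl Mcs[symmetric]] by (rule measurable_snd)
    qed (auto intro!: countable_finite finite_PiE)
    then show ?thesis by (simp add: case_prod_unfold)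
  qed
  \<comment> \<open>Reindexing a product measure along an injection preserves the product
    law.\<close>
  have pt: "(\<integral>\<^sup>+ s. q (compose {..<n} s k) \<partial>?S) = (\<integral>\<^sup>+ t. q t \<partial>?T)"
    if k: "k \<in> space ?M" "inj_on k {..<n}" for k
  proof -
    have kN: "k \<in> {..<n} \<rightarrow> {..<N}" using k by (auto simp: space_PiM space_uniform_count_measure)
    have re: "distr ?S ?T (\<lambda>s. \<lambda>i\<in>{..<n}. s (k i)) = ?T"
      by (rule distr_PiM_reindex) (use D k kN in auto)
    have "(\<lambda>s. \<lambda>i\<in>{..<n}. s (k i)) \<in> measurable ?S ?T"
      using kN by (intro measurable_restrict measurable_component_singleton) auto
    from nn_integral_distr[OF this, of q] q show ?thesis unfolding re compose_def by simp
  qed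
  have I: "{k \<in> space ?M. inj_on k {..<n}} \<in> sets ?M" by (auto simp: Mcs space_PiM space_uniform_count_measure)
  have "ennreal (1 - real n ^ 2 / real N) * (\<integral>\<^sup>+ t. q t \<partial>?T)
      \<le> emeasure ?M {k \<in> space ?M. inj_on k {..<n}} * (\<integral>\<^sup>+ t. q t \<partial>?T)"
    unfolding M.emeasure_eq_measure
    by (intro mult_right_mono ennreal_leI prob_uniform_inj_ge N) simp
  also have "\<dots> = (\<integral>\<^sup>+ k. indicator {k \<in> space ?M. inj_on k {..<n}} k * (\<integral>\<^sup>+ t. q t \<partial>?T) \<partial>?M)"
    using I by (subst nn_integral_multc) auto
  also have "\<dots> \<le> (\<integral>\<^sup>+ k. (\<integral>\<^sup>+ s. q (compose {..<n} s k) \<partial>?S) \<partial>?M)"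
    by (intro nn_integral_mono) (auto simp: indicator_def pt)
  also have "\<dots> = (\<integral>\<^sup>+ s. (\<integral>\<^sup>+ k. q (compose {..<n} s k) \<partial>?M) \<partial>?S)"
    using SM.Fubini'[of "\<lambda>s k. q (compose {..<n} s k)"] meas by simp
  also have "\<dots> = (\<integral>\<^sup>+ s. (\<integral>\<^sup>+ t. q t \<partial>(\<Pi>\<^sub>M i\<in>{..<n}. empirical D N s)) \<partial>?S)"
    by (intro nn_integral_cong) (simp add: inner)
  finally show ?thesis .
qed

text \<open>\<open>q t\<close> is the probability of \<open>S\<close> given the test sample
  \<open>t\<close>, with training sample and seed integrated out. One \<open>q\<close> serves every
  \<open>D'\<close>, so changing the test distribution changes only the outer integral.\<close>

lemma emeasure_tds_experiment_eq_nn_integral: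
  assumes D: "prob_space D" and R: "prob_space R" and f: "f \<in> measurable D labels"
    and S: "S \<in> sets (tds_inputs D m n R)"
  obtains q where "q \<in> borel_measurable (\<Pi>\<^sub>M i\<in>{..<n}. D)"
    and "\<And>D'. prob_space D' \<Longrightarrow> sets D' = sets D \<Longrightarrow>
      emeasure (tds_experiment D D' f m n R) S = (\<integral>\<^sup>+ t. q t \<partial>(\<Pi>\<^sub>M i\<in>{..<n}. D'))"
proof
  let ?Z = "\<Pi>\<^sub>M i\<in>{..<m}. labelled D f"
  let ?q = "\<lambda>t. \<integral>\<^sup>+ z. (\<integral>\<^sup>+ r. indicator S (z, t, r) \<partial>R) \<partial>?Z"
  interpret R: prob_space R by fact
  interpret Z: prob_space ?Z by (intro prob_space_PiM prob_space_labelled D f)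
  have meas: "(\<lambda>(t, z). \<integral>\<^sup>+ r. indicator S (z, t, r) \<partial>R)
      \<in> borel_measurable ((\<Pi>\<^sub>M i\<in>{..<n}. D') \<Otimes>\<^sub>M ?Z)" (is ?t1)
    and meas': "(indicator S :: _ \<Rightarrow> ennreal) \<in> borel_measurable (?Z \<Otimes>\<^sub>M (\<Pi>\<^sub>M i\<in>{..<n}. D') \<Otimes>\<^sub>M R)" (is ?t2)
    if D': "sets D' = sets D" for D'
  proof -
    have "sets (?Z \<Otimes>\<^sub>M (\<Pi>\<^sub>M i\<in>{..<n}. D') \<Otimes>\<^sub>M R) = sets (tds_inputs D m n R)"
      using sets_tds_experiment[OF D', of f m n R] unfolding tds_experiment_def .
    then show t2: ?t2 using S by (intro borel_measurable_indicator) simp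
    have "(\<lambda>p. indicator S (snd (fst p), fst (fst p), snd p) :: ennreal)
      \<in> borel_measurable (((\<Pi>\<^sub>M i\<in>{..<n}. D') \<Otimes>\<^sub>M ?Z) \<Otimes>\<^sub>M R)"
      by (rule measurable_compose[OF _ t2]) measurable
    from R.borel_measurable_nn_integral_fst[OF this] show ?t1
      by (simp add: case_prod_unfold)
  qed
  show "?q \<in> borel_measurable (\<Pi>\<^sub>M i\<in>{..<n}. D)"
    using Z.borel_measurable_nn_integral_fst[OF meas[OF refl]] by simp
  fix D' :: "'a measure" assume D': "prob_space D'" "sets D' = sets D"
  let ?T = "\<Pi>\<^sub>M i\<in>{..<n}. D'"
  interpret T: prob_space ?T by (intro prob_space_PiM D')
  interpret TR: prob_space "?T \<Otimes>\<^sub>M R" by (intro prob_space_pair T.prob_space_axioms R)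
  interpret TZ: pair_sigma_finite ?T ?Z by standard
  \<comment> \<open>Tonelli in three steps: split off the training sample, then the seed, and
    finally move the test sample outermost.\<close>
  have "emeasure (tds_experiment D D' f m n R) S = (\<integral>\<^sup>+ p. indicator S p \<partial>(?Z \<Otimes>\<^sub>M ?T \<Otimes>\<^sub>M R))"
    using S sets_tds_experiment[OF D'(2), of f m n R]
    unfolding tds_experiment_def by (subst nn_integral_indicator) simp_all
  also have "\<dots> = (\<integral>\<^sup>+ z. (\<integral>\<^sup>+ p. indicator S (z, p) \<partial>(?T \<Otimes>\<^sub>M R)) \<partial>?Z)"
    by (rule TR.nn_integral_fst[symmetric, OF meas'[OF D'(2)]])
  also have "\<dots> = (\<integral>\<^sup>+ z. (\<integral>\<^sup>+ t. (\<integral>\<^sup>+ r. indicator S (z, t, r) \<partial>R) \<partial>?T) \<partial>?Z)"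
  proof (rule nn_integral_cong)
    fix z assume z: "z \<in> space ?Z"
    have "(\<lambda>p. indicator S (z, p) :: ennreal) \<in> borel_measurable (?T \<Otimes>\<^sub>M R)"
      by (rule measurable_compose[OF measurable_Pair1'[OF z] meas'[OF D'(2)]])
    from R.nn_integral_fst[OF this]
    show "(\<integral>\<^sup>+ p. indicator S (z, p) \<partial>(?T \<Otimes>\<^sub>M R)) = (\<integral>\<^sup>+ t. (\<integral>\<^sup>+ r. indicator S (z, t, r) \<partial>R) \<partial>?T)"
      by simp
  qed
  also have "\<dots> = (\<integral>\<^sup>+ t. ?q t \<partial>?T)"
    by (rule TZ.Fubini'[OF meas[OF D'(2)]])
  finally show "emeasure (tds_experiment D D' f m n R) S = (\<integral>\<^sup>+ t. ?q t \<partial>?T)" .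
qed

text \<open>The acceptance probabilities under \<open>D\<close> and under every empirical law are
  integrals of the same \<open>q\<close>, so the comparison of test samples transfers to
  them.\<close>

lemma nn_integral_empirical_accept_ge:
  fixes D :: "'x measure"
  assumes A: "tds_algorithm D m n R A" and D: "prob_space D" and f: "f \<in> measurable D labels"
    and N: "N > 0"
  shows "ennreal (1 - real n ^ 2 / real N) * \<P>(z in tds_experiment D D f m n R. A z \<noteq> None)
    \<le> (\<integral>\<^sup>+ s. \<P>(z in tds_experiment D (empirical D N s) f m n R. A z \<noteq> None) \<partial>(\<Pi>\<^sub>M j\<in>{..<N}. D))"
proof -
  let ?I = "tds_inputs D m n R"
  define Acc where "Acc = {z \<in> space ?I. A z \<noteq> None}"
  have R: "prob_space R" using A by (simp add: tds_algorithm_def)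
  have Acc: "Acc \<in> sets ?I"
    unfolding Acc_def by (rule tds_accept_event[OF A prob_space.not_empty[OF D]])
  obtain q where q: "q \<in> borel_measurable (\<Pi>\<^sub>M i\<in>{..<n}. D)"
    and eq: "\<And>D'. prob_space D' \<Longrightarrow> sets D' = sets D \<Longrightarrow>
      emeasure (tds_experiment D D' f m n R) Acc = (\<integral>\<^sup>+ t. q t \<partial>(\<Pi>\<^sub>M i\<in>{..<n}. D'))"
    using emeasure_tds_experiment_eq_nn_integral[OF D R f Acc] by blast
  have accept: "ennreal (\<P>(z in tds_experiment D D' f m n R. A z \<noteq> None))
      = (\<integral>\<^sup>+ t. q t \<partial>(\<Pi>\<^sub>M i\<in>{..<n}. D'))"
    if D': "prob_space D'" "sets D' = sets D" for D'
  proof -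
    interpret E: prob_space "tds_experiment D D' f m n R"
      by (rule prob_space_tds_experiment[OF D D'(1) R f])
    have "{z \<in> space (tds_experiment D D' f m n R). A z \<noteq> None} = Acc"
      unfolding Acc_def sets_eq_imp_space_eq[OF sets_tds_experiment[OF D'(2)]] ..
    then show ?thesis
      using eq[OF D'] by (simp add: E.emeasure_eq_measure)
  qed
  have "ennreal (1 - real n ^ 2 / real N) * \<P>(z in tds_experiment D D f m n R. A z \<noteq> None)
      \<le> (\<integral>\<^sup>+ s. (\<integral>\<^sup>+ t. q t \<partial>(\<Pi>\<^sub>M i\<in>{..<n}. empirical D N s)) \<partial>(\<Pi>\<^sub>M j\<in>{..<N}. D))"
    unfolding accept[OF D refl] by (rule nn_integral_empirical_ge[OF D N q])
  also have "\<dots> = (\<integral>\<^sup>+ s. \<P>(z in tds_experiment D (empirical D N s) f m n R. A z \<noteq> None) \<partial>(\<Pi>\<^sub>M j\<in>{..<N}. D))"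
    by (intro nn_integral_cong accept[symmetric]) (simp_all only: N prob_space_empirical sets_empirical)
  finally show ?thesis .
qed

section \<open>Polyhedra cutting off Gaussian points\<close>

text \<open>Each \<open>s j\<close> is the normal of its own constraint; strictness excludes
  \<open>s j\<close> itself once its squared norm reaches \<open>c\<close>.\<close>

definition halfspaces :: "nat \<Rightarrow> real \<Rightarrow> nat \<Rightarrow> (nat \<Rightarrow> nat \<Rightarrow> real) \<Rightarrow> (nat \<Rightarrow> real) set" where
  "halfspaces d c N s = {x \<in> {..<d} \<rightarrow>\<^sub>E UNIV. \<forall>j<N. (\<Sum>i<d. s j i * x i) < c}"

lemma convex_in_halfspaces: "convex_in d (halfspaces d c N s)"
  unfolding convex_in_def
proof (intro conjI ballI allI impI)
  fix x y and u v :: real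
  assume x: "x \<in> halfspaces d c N s" and y: "y \<in> halfspaces d c N s"
    and uv: "0 \<le> u" "0 \<le> v" "u + v = 1"
  have "(\<Sum>i<d. s j i * (u * x i + v * y i)) < c" if j: "j < N" for j
  proof -
    have "(\<Sum>i<d. s j i * (u * x i + v * y i)) = u * (\<Sum>i<d. s j i * x i) + v * (\<Sum>i<d. s j i * y i)"
      by (simp add: sum_distrib_left sum.distrib algebra_simps)
    also have "\<dots> < c"
      using x y j uv by (intro convex_bound_lt) (auto simp: halfspaces_def)
    finally show ?thesis .
  qed
  then show "(\<lambda>i\<in>{..<d}. u * x i + v * y i) \<in> halfspaces d c N s"
    by (simp add: halfspaces_def)
qed (auto simp: halfspaces_def)

lemma sets_halfspaces: "halfspaces d c N s \<in> sets (std_gaussian d)"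
proof -
  have "{x \<in> space (std_gaussian d). \<forall>j<N. (\<Sum>i<d. s j i * x i) < c} \<in> sets (std_gaussian d)"
    by measurable
  then show ?thesis unfolding halfspaces_def space_std_gaussian .
qed

definition halfspaces_indicator ::
  "nat \<Rightarrow> real \<Rightarrow> nat \<Rightarrow> (nat \<Rightarrow> nat \<Rightarrow> real) \<Rightarrow> (nat \<Rightarrow> real) \<Rightarrow> int" where
  "halfspaces_indicator d c N s = (\<lambda>x. if x \<in> halfspaces d c N s then 1 else - 1)"

lemma halfspaces_indicator_in_convex: "halfspaces_indicator d c N s \<in> convex_indicators d"
  unfolding convex_indicators_def halfspaces_indicator_def using convex_in_halfspaces by blast

lemma measurable_halfspaces_indicator:
  "halfspaces_indicator d c N s \<in> measurable (std_gaussian d) labels"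
  unfolding halfspaces_indicator_def using sets_halfspaces[of d c N s]
  by (intro measurable_If_set) (auto simp: sets.Int_space_eq2)

text \<open>
  A sample point \<open>v\<close> spoils the construction if it is too short to be cut off by its own
  half-space, or if that half-space cuts off a training point. The weight below is the sum of
  the Chernoff bounds on the indicator of the former event and the probability of the latter.
\<close>

definition chernoff_weight :: "nat \<Rightarrow> nat \<Rightarrow> (nat \<Rightarrow> real) \<Rightarrow> real" where
  "chernoff_weight d m v =
     real m * (exp (- real d / 4) * exp (\<Sum>i<d. 1 / 8 * (v i)\<^sup>2)) +
     exp (real d / 4) * exp (\<Sum>i<d. - 1 / 2 * (v i)\<^sup>2)"

lemma chernoff_weight_nonneg: "0 \<le> chernoff_weight d m v"
  by (simp add: chernoff_weight_def)

text \<open>These are the square moments for \<open>b = 1 / 8\<close> and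
  \<open>b = - 1 / 2\<close>, where \<open>1 - 2 * b\<close> is \<open>3 / 4\<close> and
  \<open>2\<close>. Writing them as \<open>d\<close>-th powers exposes the two exponential
  rates.\<close>

lemma nn_integral_chernoff_weight:
  "(\<integral>\<^sup>+ v. ennreal (chernoff_weight d m v) \<partial>std_gaussian d)
    = ennreal (real m * (exp (- 1 / 4) * (1 / sqrt (3 / 4))) ^ d + (exp (1 / 4) * (1 / sqrt 2)) ^ d)"
proof -
  have e: "exp (real d / 4) = exp (1 / 4) ^ d" "exp (- real d / 4) = exp (- 1 / 4) ^ d"
    by (simp_all flip: exp_of_nat_mult)
  have "(\<integral>\<^sup>+ v. ennreal (chernoff_weight d m v) \<partial>std_gaussian d)
    = ennreal (real m * exp (- real d / 4)) * (\<integral>\<^sup>+ v. ennreal (exp (\<Sum>i<d. 1 / 8 * (v i)\<^sup>2)) \<partial>std_gaussian d)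
      + ennreal (exp (real d / 4)) * (\<integral>\<^sup>+ v. ennreal (exp (\<Sum>i<d. - 1 / 2 * (v i)\<^sup>2)) \<partial>std_gaussian d)"
    unfolding chernoff_weight_def
    by (subst (1 2) nn_integral_cmult[symmetric], measurable, subst nn_integral_add[symmetric])
       (auto intro!: nn_integral_cong simp: ennreal_plus ennreal_mult' mult.assoc)
  also have "\<dots> = ennreal (real m * exp (- real d / 4)) * ennreal ((1 / sqrt (3 / 4)) ^ d)
      + ennreal (exp (real d / 4)) * ennreal ((1 / sqrt 2) ^ d)"
    by (subst (1 2) nn_integral_std_gaussian_exp_square) simp_all
  also have "\<dots> = ennreal (real m * exp (- real d / 4) * (1 / sqrt (3 / 4)) ^ d + exp (real d / 4) * (1 / sqrt 2) ^ d)"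
    by (simp add: ennreal_mult' ennreal_plus)
  finally show ?thesis
    unfolding e power_mult_distrib by (simp add: mult.assoc)
qed

text \<open>With \<open>0\<close> half-spaces the polyhedron is the whole space, whatever \<open>c\<close> and \<open>s'\<close> are.\<close>

lemma accept_prob_empirical_le:
  assumes L: "tds_learner (std_gaussian d) (convex_indicators d) \<epsilon> \<delta> m n R A"
    and \<epsilon>: "\<epsilon> < 1 / 2" and \<delta>: "\<delta> \<ge> 0" and N: "N > 0"
    and s: "s \<in> space (\<Pi>\<^sub>M j\<in>{..<N}. std_gaussian d)"
  shows "\<P>(z in tds_experiment (std_gaussian d) (empirical (std_gaussian d) N s)
      (halfspaces_indicator d c 0 s') m n R. A z \<noteq> None)
    \<le> 2 * \<delta> + (\<Sum>j<N. chernoff_weight d m (s j))" (is "?P \<le> _")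
proof -
  let ?D = "std_gaussian d" and ?f = "halfspaces_indicator d c 0 s'"
    and ?g = "halfspaces_indicator d (real d / 2) N s"
  let ?D' = "empirical ?D N s"
  interpret D: prob_space ?D by (rule prob_space_std_gaussian)
  have R: "prob_space R" using L by (simp add: tds_learner_def tds_algorithm_def)
  have D': "prob_space ?D'" "sets ?D' = sets ?D"
    using s N by (rule prob_space_empirical, rule sets_empirical)
  have sj: "s j \<in> space ?D" if "j < N" for j using s that by (auto simp: space_PiM)
  have f1: "?f x = 1" if "x \<in> space ?D" for x
    using that by (simp add: halfspaces_indicator_def halfspaces_def space_std_gaussian)
  have fg: "{x \<in> space ?D. ?f x \<noteq> ?g x}
      = (\<Union>j<N. {x \<in> space ?D. real d / 2 \<le> (\<Sum>i<d. s j i * x i)})"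
    using f1 by (auto simp: halfspaces_indicator_def halfspaces_def space_std_gaussian not_less)
  have W: "0 \<le> chernoff_weight d m (s j)" for j by (rule chernoff_weight_nonneg)
  show ?thesis
  \<comment> \<open>If some point is too short, the second term of its weight is already at least 1
    and the bound is trivial. Otherwise every \<open>s j\<close> is cut off and the two truths
    disagree on the whole support.\<close>
  proof (cases "\<forall>j<N. real d / 2 \<le> (\<Sum>i<d. (s j i)\<^sup>2)")
    case False
    then obtain j where j: "j < N" "(\<Sum>i<d. (s j i)\<^sup>2) < real d / 2" by (auto simp: not_le)
    have "exp (real d / 4) * exp (\<Sum>i<d. - 1 / 2 * (s j i)\<^sup>2)
        = exp (real d / 4 - 1 / 2 * (\<Sum>i<d. (s j i)\<^sup>2))"
      by (simp add: exp_add[symmetric] sum_distrib_left sum_negf)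
    also have "\<dots> \<ge> 1" using j by simp
    finally have "1 \<le> chernoff_weight d m (s j)"
      unfolding chernoff_weight_def by (rule order_trans) simp
    also have "\<dots> \<le> (\<Sum>j<N. chernoff_weight d m (s j))"
      using j W by (intro member_le_sum) auto
    finally have "1 \<le> (\<Sum>j<N. chernoff_weight d m (s j))" .
    moreover have "?P \<le> 1"
    proof -
      interpret E: prob_space "tds_experiment ?D ?D' ?f m n R"
        by (intro prob_space_tds_experiment D.prob_space_axioms D' R measurable_halfspaces_indicator)
      show ?thesis by (rule E.prob_le_1)
    qed
    ultimately show ?thesis using \<delta> by linarith
  next
    case True
    have H: "D.prob {x \<in> space ?D. real d / 2 \<le> (\<Sum>i<d. s j i * x i)}
        \<le> exp (- real d / 4) * exp (\<Sum>i<d. 1 / 8 * (s j i)\<^sup>2)" for j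
      using emeasure_std_gaussian_halfspace_le[of "1 / 2" d "real d / 2" "s j"]
      unfolding D.emeasure_eq_measure by (simp add: power_divide)
    have "\<P>(x in ?D'. ?f x \<noteq> ?g x) = 1"
    proof (rule prob_empirical_eq_1[OF s N])
      show "{x \<in> space ?D. ?f x \<noteq> ?g x} \<in> sets ?D" unfolding fg by measurable
      fix j assume j: "j < N"
      then have "s j \<in> {x \<in> space ?D. ?f x \<noteq> ?g x}"
        unfolding fg using True sj by (auto simp: power2_eq_square)
      then show "?f (s j) \<noteq> ?g (s j)" by simp
    qed
    then have "?P \<le> 2 * \<delta> + real m * \<P>(x in ?D. ?f x \<noteq> ?g x)"
      by (intro tds_accept_prob_le[OF L D.prob_space_axioms D'])
         (use \<epsilon> halfspaces_indicator_in_convex measurable_halfspaces_indicator in auto)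
    also have "\<P>(x in ?D. ?f x \<noteq> ?g x)
        \<le> (\<Sum>j<N. D.prob {x \<in> space ?D. real d / 2 \<le> (\<Sum>i<d. s j i * x i)})"
      unfolding fg by (rule D.finite_measure_subadditive_finite) auto
    also have "\<dots> \<le> (\<Sum>j<N. exp (- real d / 4) * exp (\<Sum>i<d. 1 / 8 * (s j i)\<^sup>2))"
      by (intro sum_mono H)
    \<comment> \<open>What remains is the first summand of each weight; the second is
      nonnegative.\<close>
    also have "real m * \<dots> \<le> (\<Sum>j<N. chernoff_weight d m (s j))"
      unfolding sum_distrib_left by (intro sum_mono) (simp add: chernoff_weight_def)
    finally show ?thesis by (simp add: mult_left_mono)
  qed
qed

text \<open>Both sides enclose the acceptance probability averaged over \<open>s\<close>:
  completeness and the birthday bound give the lower estimate, soundness and the mean weights the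
  upper one.\<close>

lemma tds_learner_convex_bound:
  assumes L: "tds_learner (std_gaussian d) (convex_indicators d) \<epsilon> \<delta> m n R A"
    and \<epsilon>: "\<epsilon> < 1 / 2" and \<delta>: "0 \<le> \<delta>" "\<delta> \<le> 1" and N: "N > 0" "real n ^ 2 \<le> real N"
  shows "(1 - real n ^ 2 / real N) * (1 - \<delta>) \<le> 2 * \<delta> + real N *
    (real m * (exp (- 1 / 4) * (1 / sqrt (3 / 4))) ^ d + (exp (1 / 4) * (1 / sqrt 2)) ^ d)"
proof -
  let ?D = "std_gaussian d"
  let ?S = "\<Pi>\<^sub>M j\<in>{..<N}. ?D"
  let ?W = "real m * (exp (- 1 / 4) * (1 / sqrt (3 / 4))) ^ d + (exp (1 / 4) * (1 / sqrt 2)) ^ d"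
  \<comment> \<open>With no half-spaces this truth is the whole space; the threshold and the normals
    are placeholders.\<close>
  define f where "f = halfspaces_indicator d 0 0 (\<lambda>_ _. 0)"
  have f: "f \<in> convex_indicators d" "f \<in> measurable ?D labels"
    unfolding f_def by (rule halfspaces_indicator_in_convex measurable_halfspaces_indicator)+
  interpret D: prob_space ?D by (rule prob_space_std_gaussian)
  interpret S: prob_space ?S by (intro prob_space_PiM D.prob_space_axioms)
  have w: "(\<lambda>v. ennreal (chernoff_weight d m v)) \<in> borel_measurable ?D"
    unfolding chernoff_weight_def by measurable
  have comp: "(\<lambda>s. s j) \<in> measurable ?S ?D" if "j < N" for j
    by (rule measurable_component_singleton) (use that in simp)
  have marg: "(\<integral>\<^sup>+ s. ennreal (chernoff_weight d m (s j)) \<partial>?S) = ennreal ?W" if "j < N" for j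
  proof -
    have "distr ?S ?D (\<lambda>s. s j) = ?D"
      by (rule distr_PiM_component) (use that D.prob_space_axioms in auto)
    then show ?thesis
      using nn_integral_distr[OF comp[OF that], of "\<lambda>v. ennreal (chernoff_weight d m v)"] w
      by (simp add: nn_integral_chernoff_weight)
  qed
  have "ennreal ((1 - real n ^ 2 / real N) * (1 - \<delta>))
      \<le> ennreal (1 - real n ^ 2 / real N) * ennreal (\<P>(z in tds_experiment ?D ?D f m n R. A z \<noteq> None))"
  proof -
    have "1 - \<delta> \<le> \<P>(z in tds_experiment ?D ?D f m n R. A z \<noteq> None)"
      using L f by (auto simp: tds_learner_def tds_complete_def)
    then show ?thesis
      using N by (subst ennreal_mult'[symmetric]) (auto intro!: ennreal_leI mult_left_mono simp: divide_le_eq_1)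
  qed
  also have "\<dots> \<le> (\<integral>\<^sup>+ s. \<P>(z in tds_experiment ?D (empirical ?D N s) f m n R. A z \<noteq> None) \<partial>?S)"
    using L f N by (intro nn_integral_empirical_accept_ge D.prob_space_axioms) (auto simp: tds_learner_def)
  \<comment> \<open>The estimate holds for each \<open>s\<close> and is a sum over \<open>j\<close>,
    so its mean follows from the marginals \<open>marg\<close>.\<close>
  also have "\<dots> \<le> (\<integral>\<^sup>+ s. ennreal (2 * \<delta>) + (\<Sum>j<N. ennreal (chernoff_weight d m (s j))) \<partial>?S)"
  proof (intro nn_integral_mono)
    fix s assume s: "s \<in> space ?S"
    have "ennreal (\<P>(z in tds_experiment ?D (empirical ?D N s) f m n R. A z \<noteq> None))
        \<le> ennreal (2 * \<delta> + (\<Sum>j<N. chernoff_weight d m (s j)))"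
      unfolding f_def by (rule ennreal_leI[OF accept_prob_empirical_le[OF L \<epsilon> \<delta>(1) N(1) s]])
    then show "ennreal (\<P>(z in tds_experiment ?D (empirical ?D N s) f m n R. A z \<noteq> None))
        \<le> ennreal (2 * \<delta>) + (\<Sum>j<N. ennreal (chernoff_weight d m (s j)))"
      using \<delta> by (simp add: ennreal_plus sum_nonneg sum_ennreal chernoff_weight_nonneg)
  qed
  also have "\<dots> = ennreal (2 * \<delta>) + (\<Sum>j<N. \<integral>\<^sup>+ s. ennreal (chernoff_weight d m (s j)) \<partial>?S)"
  proof -
    have w': "(\<lambda>s. ennreal (chernoff_weight d m (s j))) \<in> borel_measurable ?S" if "j \<in> {..<N}" for j
      by (rule measurable_compose[OF comp w]) (use that in simp)
    have "(\<integral>\<^sup>+ s. (\<Sum>j<N. ennreal (chernoff_weight d m (s j))) \<partial>?S)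
        = (\<Sum>j<N. \<integral>\<^sup>+ s. ennreal (chernoff_weight d m (s j)) \<partial>?S)"
      by (rule nn_integral_sum[OF w'])
    moreover have "(\<lambda>s. \<Sum>j<N. ennreal (chernoff_weight d m (s j))) \<in> borel_measurable ?S"
      by (rule borel_measurable_sum[OF w'])
    ultimately show ?thesis
      by (subst nn_integral_add) (simp_all add: S.emeasure_space_1)
  qed
  also have "\<dots> = ennreal (2 * \<delta>) + of_nat N * ennreal ?W"
    by (simp add: marg)
  also have "\<dots> = ennreal (2 * \<delta> + real N * ?W)"
    using \<delta> by (simp add: ennreal_plus ennreal_mult' ennreal_of_nat_eq_real_of_nat)
  finally show ?thesis
    using \<delta> by (subst (asm) ennreal_le_iff) auto
qed

section \<open>Numerical decay rates\<close>

lemma exp_1_ge: "exp 1 \<ge> (2.6 :: real)"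
proof -
  \<comment> \<open>\<open>1 + 1 / 2 + 1 / 8 = 1.625\<close>, whose square is above
    \<open>2.6\<close>.\<close>
  have "(1.625 :: real) \<le> exp (1 / 2)"
    using exp_lower_Taylor_quadratic[of "1 / 2"] by (simp add: power2_eq_square)
  then have "(1.625 :: real) ^ 2 \<le> exp (1 / 2) ^ 2" by (rule power_mono) simp
  also have "exp (1 / 2) ^ 2 = (exp 1 :: real)" by (simp flip: exp_of_nat_mult)
  finally show ?thesis by (simp add: power2_eq_square)
qed

text \<open>The exponent is \<open>3 * 0.04\<close>: two factors from \<open>N\<close>, of order
  \<open>n\<^sup>2\<close>, and one from \<open>m\<close>. The 100th power clears roots and
  fractional exponents and leaves a rational comparison.\<close>

lemma halfspace_rate_less_1: "2 powr 0.12 * (exp (- 1 / 4) * (1 / sqrt (3 / 4))) < (1 :: real)" (is "?a < 1")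
proof -
  have r: "sqrt (3 / 4) ^ 100 = (3 / 4 :: real) ^ 50"
    using power_mult[of "sqrt (3 / 4)" 2 50] by simp
  have e: "exp (- 1 / 4) ^ 100 = 1 / (exp 1 ^ 25 :: real)"
    using exp_of_nat_mult[of 100 "- 1 / 4 :: real"] exp_of_nat_mult[of 25 "1 :: real"]
    by (simp add: exp_minus inverse_eq_divide power_divide)
  have p: "(2 powr 0.12) ^ 100 = (2 ^ 12 :: real)"
    by (simp add: powr_realpow[symmetric] powr_powr del: powr_numeral)
  have "?a ^ 100 = (2 powr 0.12) ^ 100 * (exp (- 1 / 4) ^ 100 * (1 / sqrt (3 / 4) ^ 100))"
    by (simp only: power_mult_distrib power_divide power_one)
  also have "\<dots> = 2 ^ 12 / (exp 1 ^ 25 * (3 / 4) ^ 50)"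
    unfolding r e p by simp
  also have "\<dots> \<le> 2 ^ 12 / (2.6 ^ 25 * (3 / 4) ^ 50)"
    using power_mono[OF exp_1_ge, of 25] by (intro divide_left_mono mult_right_mono) auto
  also have "\<dots> < 1" by (simp add: power_divide)
  finally have "?a ^ 100 < 1 ^ 100" by simp
  then show ?thesis by (rule power_less_imp_less_base) simp
qed

text \<open>Here the exponent is \<open>2 * 0.04\<close>, from \<open>N\<close> alone; after the
  100th power the bound \<open>exp 1 \<le> 3\<close> suffices.\<close>

lemma norm_rate_less_1: "2 powr 0.08 * (exp (1 / 4) * (1 / sqrt 2)) < (1 :: real)" (is "?a < 1")
proof -
  have r: "sqrt 2 ^ 100 = (2 :: real) ^ 50"
    using power_mult[of "sqrt 2" 2 50] by simp
  have e: "exp (1 / 4) ^ 100 = (exp 1 ^ 25 :: real)"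
    by (simp flip: exp_of_nat_mult)
  have p: "(2 powr 0.08) ^ 100 = (2 ^ 8 :: real)"
    by (simp add: powr_realpow[symmetric] powr_powr del: powr_numeral)
  have "?a ^ 100 = (2 powr 0.08) ^ 100 * (exp (1 / 4) ^ 100 * (1 / sqrt 2 ^ 100))"
    by (simp only: power_mult_distrib power_divide power_one)
  also have "\<dots> = 2 ^ 8 * exp 1 ^ 25 / 2 ^ 50"
    unfolding r e p by simp
  also have "\<dots> \<le> 2 ^ 8 * 3 ^ 25 / 2 ^ 50"
    using power_mono[OF exp_le, of 25] by (intro divide_right_mono mult_left_mono) auto
  also have "\<dots> < 1" by simp
  finally have "?a ^ 100 < 1 ^ 100" by simp
  then show ?thesis by (rule power_less_imp_less_base) simp
qed

text \<open>Larger parameters enlarge the soundness event and lower the required probabilities. This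
  reduces the theorem to both parameters equal to \<open>0.1\<close>, with no sign condition on the
  given ones.\<close>

lemma tds_learner_mono:
  assumes "tds_learner D C \<epsilon> \<delta> m n R A" "\<epsilon> \<le> \<epsilon>'" "\<delta> \<le> \<delta>'" "prob_space D"
  shows "tds_learner D C \<epsilon>' \<delta>' m n R A"
proof -
  have A: "tds_algorithm D m n R A" and R: "prob_space R"
    using assms(1) by (auto simp: tds_learner_def tds_algorithm_def)
  have "tds_complete D C \<delta>' m n R A"
    using assms(1,3) unfolding tds_learner_def tds_complete_def by force
  moreover have "tds_sound D C \<epsilon>' \<delta>' m n R A"
    unfolding tds_sound_def
  proof (intro ballI allI impI, elim conjE)
    fix f and D' :: "'a measure"
    assume f: "f \<in> C \<inter> measurable D labels" and D': "prob_space D'" "sets D' = sets D"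
    let ?E = "tds_experiment D D' f m n R"
    interpret E: prob_space ?E
      by (rule prob_space_tds_experiment) (use assms(4) f D' R in auto)
    have "1 - \<delta>' \<le> \<P>(z in ?E. \<forall>h. A z = Some h \<longrightarrow> \<P>(x in D'. h x \<noteq> f x) \<le> \<epsilon>)"
      using assms(1,3) f D' unfolding tds_learner_def tds_sound_def by force
    also have "\<dots> \<le> \<P>(z in ?E. \<forall>h. A z = Some h \<longrightarrow> \<P>(x in D'. h x \<noteq> f x) \<le> \<epsilon>')"
    proof (rule E.finite_measure_mono)
      show "{z \<in> space ?E. \<forall>h. A z = Some h \<longrightarrow> \<P>(x in D'. h x \<noteq> f x) \<le> \<epsilon>'} \<in> sets ?E"
        by (rule tds_sound_event[OF A D']) (use f in simp)
    qed (use assms(2) order_trans in blast)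
    finally show "1 - \<delta>' \<le> \<P>(z in ?E. \<forall>h. A z = Some h \<longrightarrow> \<P>(x in D'. h x \<noteq> f x) \<le> \<epsilon>')" .
  qed
  ultimately show ?thesis using A by (simp add: tds_learner_def)
qed

theorem theorem2p11:
  "\<forall>\<^sub>F d in sequentially. \<forall>(\<epsilon>::real) (\<delta>::real) (m::nat) (n::nat) (R::real measure) A.
     \<epsilon> \<le> 0.1 \<longrightarrow> \<delta> \<le> 0.1 \<longrightarrow>
     tds_learner (std_gaussian d) (convex_indicators d) \<epsilon> \<delta> m n R A \<longrightarrow>
     real m \<ge> 2 powr (0.04 * real d) \<or> real n \<ge> 2 powr (0.04 * real d)"
proof -
  define \<alpha> :: real where "\<alpha> = exp (- 1 / 4) * (1 / sqrt (3 / 4))"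
  define \<beta> :: real where "\<beta> = exp (1 / 4) * (1 / sqrt 2)"
  have nonneg: "0 \<le> \<alpha>" "0 \<le> \<beta>" by (simp_all add: \<alpha>_def \<beta>_def)
  have "(\<lambda>d. 3 * ((2 powr 0.12 * \<alpha>) ^ d + (2 powr 0.08 * \<beta>) ^ d)) \<longlonglongrightarrow> 3 * (0 + 0)"
    using nonneg halfspace_rate_less_1 norm_rate_less_1
    by (intro tendsto_intros LIMSEQ_realpow_zero) (simp_all add: \<alpha>_def \<beta>_def)
  \<comment> \<open>The final comparison is \<open>0.45\<close> against \<open>0.2\<close> plus this
    error, so any threshold up to \<open>0.25\<close> would do.\<close>
  then have "\<forall>\<^sub>F d in sequentially. 3 * ((2 powr 0.12 * \<alpha>) ^ d + (2 powr 0.08 * \<beta>) ^ d) < 0.2"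
    by (rule order_tendstoD) simp
  then show ?thesis
  proof (eventually_elim, intro allI impI)
    fix d m n :: nat and \<epsilon> \<delta> :: real and R :: "real measure" and A
    assume small: "3 * ((2 powr 0.12 * \<alpha>) ^ d + (2 powr 0.08 * \<beta>) ^ d) < 0.2"
      and \<epsilon>\<delta>: "\<epsilon> \<le> 0.1" "\<delta> \<le> 0.1"
      and learner: "tds_learner (std_gaussian d) (convex_indicators d) \<epsilon> \<delta> m n R A"
    have L: "tds_learner (std_gaussian d) (convex_indicators d) 0.1 0.1 m n R A"
      by (rule tds_learner_mono[OF learner \<epsilon>\<delta> prob_space_std_gaussian])
    define b :: real where "b = 2 powr (0.04 * real d)"
    have b: "b \<ge> 1" by (simp add: b_def ge_one_powr_ge_zero)
    have pw: "(2 powr 0.12) ^ d = b ^ 3" "(2 powr 0.08) ^ d = b ^ 2"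
      by (simp_all add: b_def powr_realpow[symmetric] powr_powr mult.commute del: powr_numeral)
    show "real m \<ge> 2 powr (0.04 * real d) \<or> real n \<ge> 2 powr (0.04 * real d)"
    proof (rule ccontr)
      assume "\<not> ?thesis"
      then have mn: "real m \<le> b" "real n \<le> b" by (auto simp: b_def)
      \<comment> \<open>This keeps the collision probability at most \<open>1 / 2\<close>; the added
        1 makes \<open>N\<close> positive also for \<open>n = 0\<close>, and
        \<open>b \<ge> 1\<close> absorbs it in \<open>N \<le> 3 * b\<^sup>2\<close>.\<close>
      define N where "N = 2 * n\<^sup>2 + 1"
      have N0: "N > 0" and rN: "real N = 2 * real n ^ 2 + 1"
        by (simp_all add: N_def)
      have Nn: "real n ^ 2 / real N \<le> 1 / 2" "real n ^ 2 \<le> real N"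
        using N0 rN by (simp_all add: field_simps)
      have "real n ^ 2 \<le> b ^ 2" using mn by (intro power_mono) simp_all
      moreover have "1 \<le> b ^ 2" using b by (rule one_le_power)
      ultimately have N: "real N \<le> 3 * b ^ 2" unfolding rN by linarith
      have "(1 - 1 / 2) * (1 - 0.1) \<le> (1 - real n ^ 2 / real N) * (1 - 0.1 :: real)"
        using Nn by (intro mult_right_mono) auto
      also have "\<dots> \<le> 2 * 0.1 + real N * (real m * \<alpha> ^ d + \<beta> ^ d)"
        unfolding \<alpha>_def \<beta>_def by (rule tds_learner_convex_bound[OF L]) (use Nn N0 in auto)
      also have "real N * (real m * \<alpha> ^ d + \<beta> ^ d) \<le> 3 * b ^ 2 * (b * \<alpha> ^ d + \<beta> ^ d)"
        using N mn nonneg b by (intro mult_mono add_mono) auto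
      also have "\<dots> = 3 * ((2 powr 0.12 * \<alpha>) ^ d + (2 powr 0.08 * \<beta>) ^ d)"
        unfolding power_mult_distrib pw by (simp add: algebra_simps power2_eq_square power3_eq_cube)
      \<comment> \<open>The chain gives \<open>0.45 \<le> 0.2 + error\<close> with an error below
        \<open>0.2\<close>.\<close>
      finally show False using small by simp
    qed
  qed
qed

end
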